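(* $\pi_1(\mathcal{N})\cong Q_8$ and $\mathbb{S}^3$ is the universal covering space of $\mathcal{N}$. Here $Q_8$ is the quaternion group, i.e. $Q_8=\{\pm1,\pm\mathrm{i},\pm\mathrm{j},\pm\mathrm{k}\}$ with the relations $\mathrm{i}^2=\mathrm{j}^2=\mathrm{k}^2=\mathrm{i}\mathrm{j}\mathrm{k}=-1$.
   Context: $r_*>0$ is a fixed constant and $\mathcal{N}=\{r_*(\mathbf{n}\otimes\mathbf{n}-\mathbf{m}\otimes\mathbf{m}):\mathbf{n},\mathbf{m}\in\mathbb{S}^2,\ \mathbf{n}\cdot\mathbf{m}=0\}$, a compact smooth $3$-dimensional submanifold of the space of real symmetric traceless $3\times3$ matrices. *)

theory Defs
  imports "HOL-Analysis.Analysis" "HOL-Algebra.Group"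
begin

definition loops_at :: "'a::real_normed_vector set \<Rightarrow> 'a \<Rightarrow> (real \<Rightarrow> 'a) set" where
  "loops_at S a = {p. path p \<and> path_image p \<subseteq> S \<and> pathstart p = a \<and> pathfinish p = a}"

definition path_class :: "'a::real_normed_vector set \<Rightarrow> (real \<Rightarrow> 'a) \<Rightarrow> (real \<Rightarrow> 'a) set" where
  "path_class S p = {q. homotopic_paths S p q}"

text \<open>The union in the product is over all representatives; it is a single class because
  concatenation respects homotopy.\<close>

definition fundamental_group :: "'a::real_normed_vector set \<Rightarrow> 'a \<Rightarrow> (real \<Rightarrow> 'a) set monoid" where
  "fundamental_group S a =
     \<lparr>carrier = path_class S ` loops_at S a,
      monoid.mult = (\<lambda>P Q. \<Union>p\<in>P. \<Union>q\<in>Q. path_class S (p +++ q)),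
      one = path_class S (linepath a a)\<rparr>"

lemma path_class_eqI: "homotopic_paths S p q \<Longrightarrow> path_class S p = path_class S q"
  unfolding path_class_def by (auto intro: homotopic_paths_trans homotopic_paths_sym)

lemma fundamental_group_mult:
  assumes "p \<in> loops_at S a" "q \<in> loops_at S a"
  shows "path_class S p \<otimes>\<^bsub>fundamental_group S a\<^esub> path_class S q = path_class S (p +++ q)"
proof -
  have eq: "path_class S (p' +++ q') = path_class S (p +++ q)"
    if "p' \<in> path_class S p" "q' \<in> path_class S q" for p' q'
  proof (rule path_class_eqI[OF homotopic_paths_sym], rule homotopic_paths_join)
    show "homotopic_paths S p p'" "homotopic_paths S q q'"
      using that by (auto simp: path_class_def)
    show "pathfinish p = pathstart q"
      using assms by (simp add: loops_at_def)
  qed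
  have ne: "path_class S p \<noteq> {}" "path_class S q \<noteq> {}"
    using assms homotopic_paths_refl unfolding path_class_def loops_at_def by blast+
  have "(\<Union>p'\<in>path_class S p. \<Union>q'\<in>path_class S q. path_class S (p' +++ q')) =
      (\<Union>p'\<in>path_class S p. \<Union>q'\<in>path_class S q. path_class S (p +++ q))"
    by (intro SUP_cong refl eq)
  then show ?thesis
    using ne by (simp add: fundamental_group_def)
qed

lemma loops_at_join: "p \<in> loops_at S a \<Longrightarrow> q \<in> loops_at S a \<Longrightarrow> p +++ q \<in> loops_at S a"
  by (simp add: loops_at_def path_image_join)

lemma loops_at_reverse: "p \<in> loops_at S a \<Longrightarrow> reversepath p \<in> loops_at S a"
  by (simp add: loops_at_def)

lemma group_fundamental_group:
  assumes "a \<in> S"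
  shows "group (fundamental_group S a)"
proof -
  let ?G = "fundamental_group S a"
  have car: "carrier ?G = path_class S ` loops_at S a"
    and one: "\<one>\<^bsub>?G\<^esub> = path_class S (linepath a a)"
    by (simp_all add: fundamental_group_def)
  have c: "linepath a a \<in> loops_at S a"
    using assms by (simp add: loops_at_def)
  show ?thesis
  proof (rule groupI)
    fix x y assume "x \<in> carrier ?G" "y \<in> carrier ?G"
    then show "x \<otimes>\<^bsub>?G\<^esub> y \<in> carrier ?G"
      unfolding car by (auto simp: fundamental_group_mult loops_at_join)
  next
    show "\<one>\<^bsub>?G\<^esub> \<in> carrier ?G"
      unfolding car one using c by blast
  next
    fix x y z assume "x \<in> carrier ?G" "y \<in> carrier ?G" "z \<in> carrier ?G"
    then obtain p q r where pqr: "p \<in> loops_at S a" "q \<in> loops_at S a" "r \<in> loops_at S a"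
      and e: "x = path_class S p" "y = path_class S q" "z = path_class S r"
      unfolding car by blast
    have "path_class S ((p +++ q) +++ r) = path_class S (p +++ (q +++ r))"
      by (rule path_class_eqI[OF homotopic_paths_sym], rule homotopic_paths_assoc)
         (use pqr in \<open>auto simp: loops_at_def\<close>)
    then show "x \<otimes>\<^bsub>?G\<^esub> y \<otimes>\<^bsub>?G\<^esub> z = x \<otimes>\<^bsub>?G\<^esub> (y \<otimes>\<^bsub>?G\<^esub> z)"
      using pqr by (simp add: e fundamental_group_mult loops_at_join)
  next
    fix x assume "x \<in> carrier ?G"
    then obtain p where p: "p \<in> loops_at S a" and e: "x = path_class S p"
      unfolding car by blast
    show "\<one>\<^bsub>?G\<^esub> \<otimes>\<^bsub>?G\<^esub> x = x"
      unfolding one e fundamental_group_mult[OF c p]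
      by (rule path_class_eqI) (use p in \<open>auto simp: loops_at_def intro!: homotopic_paths_lid'\<close>)
    have "path_class S (reversepath p) \<otimes>\<^bsub>?G\<^esub> x = \<one>\<^bsub>?G\<^esub>"
      unfolding one e fundamental_group_mult[OF loops_at_reverse[OF p] p]
      by (rule path_class_eqI)
         (use p homotopic_paths_linv[of p S] in \<open>auto simp: loops_at_def\<close>)
    then show "\<exists>y\<in>carrier ?G. y \<otimes>\<^bsub>?G\<^esub> x = \<one>\<^bsub>?G\<^esub>"
      unfolding car using loops_at_reverse[OF p] by blast
  qed
qed

text \<open>The constant \<^const>\<open>simply_connected\<close> includes path-connectedness.\<close>

definition universal_covering_space ::
    "'a::topological_space set \<Rightarrow> ('a \<Rightarrow> 'b) \<Rightarrow> 'b::topological_space set \<Rightarrow> bool" where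
  "universal_covering_space C p S \<longleftrightarrow> covering_space C p S \<and> simply_connected C"

datatype quat_unit = QE | QI | QJ | QK

fun quat_unit_mult :: "quat_unit \<Rightarrow> quat_unit \<Rightarrow> int \<times> quat_unit" where
  "quat_unit_mult QE b  = (1, b)"
| "quat_unit_mult a  QE = (1, a)"
| "quat_unit_mult QI QI = (-1, QE)"
| "quat_unit_mult QJ QJ = (-1, QE)"
| "quat_unit_mult QK QK = (-1, QE)"
| "quat_unit_mult QI QJ = (1, QK)"
| "quat_unit_mult QJ QK = (1, QI)"
| "quat_unit_mult QK QI = (1, QJ)"
| "quat_unit_mult QJ QI = (-1, QK)"
| "quat_unit_mult QK QJ = (-1, QI)"
| "quat_unit_mult QI QK = (-1, QJ)"

text \<open>The pair \<open>(s, a)\<close> with \<open>s = 1\<close> or \<open>s = -1\<close> stands for the signed unit \<open>s a\<close>.\<close>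

definition Q8 :: "(int \<times> quat_unit) monoid" where
  "Q8 = \<lparr>carrier = {1, -1} \<times> {QE, QI, QJ, QK},
         monoid.mult = (\<lambda>(s, a) (t, b). case quat_unit_mult a b of (u, c) \<Rightarrow> (s * t * u, c)),
         one = (1, QE)\<rparr>"

lemma Q8_group: "group Q8"
proof (rule groupI)
  fix x y z assume "x \<in> carrier Q8" "y \<in> carrier Q8" "z \<in> carrier Q8"
  obtain s a t b u c where e: "x = (s, a)" "y = (t, b)" "z = (u, c)"
    by (metis prod.exhaust)
  show "x \<otimes>\<^bsub>Q8\<^esub> y \<otimes>\<^bsub>Q8\<^esub> z = x \<otimes>\<^bsub>Q8\<^esub> (y \<otimes>\<^bsub>Q8\<^esub> z)"
    unfolding e by (cases a; cases b; cases c; simp add: Q8_def)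
next
  fix x y assume "x \<in> carrier Q8" "y \<in> carrier Q8"
  moreover obtain s a t b where e: "x = (s, a)" "y = (t, b)"
    by (metis prod.exhaust)
  ultimately show "x \<otimes>\<^bsub>Q8\<^esub> y \<in> carrier Q8"
    unfolding e by (cases a; cases b) (auto simp: Q8_def)
next
  show "\<one>\<^bsub>Q8\<^esub> \<in> carrier Q8"
    by (simp add: Q8_def)
next
  fix x assume x: "x \<in> carrier Q8"
  obtain s a where e: "x = (s, a)"
    by (metis prod.exhaust)
  show "\<one>\<^bsub>Q8\<^esub> \<otimes>\<^bsub>Q8\<^esub> x = x"
    by (simp add: e Q8_def)
  have "(if a = QE then s else - s, a) \<in> carrier Q8"
    and "(if a = QE then s else - s, a) \<otimes>\<^bsub>Q8\<^esub> x = \<one>\<^bsub>Q8\<^esub>"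
    using x by (cases a; auto simp: e Q8_def)+
  then show "\<exists>y\<in>carrier Q8. y \<otimes>\<^bsub>Q8\<^esub> x = \<one>\<^bsub>Q8\<^esub>"
    by blast
qed

lemma Q8_card: "card (carrier Q8) = 8"
  by (simp add: Q8_def card_cartesian_product)

lemma Q8_relations:
  "(1, QI) \<otimes>\<^bsub>Q8\<^esub> (1, QI) = (-1, QE)"
  "(1, QJ) \<otimes>\<^bsub>Q8\<^esub> (1, QJ) = (-1, QE)"
  "(1, QK) \<otimes>\<^bsub>Q8\<^esub> (1, QK) = (-1, QE)"
  "(1, QI) \<otimes>\<^bsub>Q8\<^esub> (1, QJ) \<otimes>\<^bsub>Q8\<^esub> (1, QK) = (-1, QE)"
  by (simp_all add: Q8_def)

definition tensor_vec :: "real^3 \<Rightarrow> real^3 \<Rightarrow> real^3^3"  (infixl \<open>\<otimes>\<^sub>v\<close> 75) where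
  "u \<otimes>\<^sub>v v = (\<chi> i j. u $ i * v $ j)"

definition biaxial_manifold :: "real \<Rightarrow> (real^3^3) set" where
  "biaxial_manifold r =
     {r *\<^sub>R (n \<otimes>\<^sub>v n - m \<otimes>\<^sub>v m) | n m. n \<in> sphere 0 1 \<and> m \<in> sphere 0 1 \<and> n \<bullet> m = 0}"

end

theory Submission
  imports Defs "HOL-Analysis.Cross3"
begin

text \<open>
  Write a quaternion as a vector of \<open>\<real>\<^sup>4\<close>. A unit quaternion \<open>q\<close> acts on \<open>\<real>\<^sup>3\<close> by the rotation
  \<open>x \<mapsto> q\<^sup>-\<^sup>1 x q\<close>, and sending \<open>q\<close> to the tensor built from the rotated frame maps \<open>S\<^sup>3\<close> onto
  \<open>\<N>\<close>. The tensor determines the frame vectors \<open>n\<close> and \<open>m\<close> up to sign, and the sign changes are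
  realised by left multiplication with the eight quaternion units; so the fibres are the orbits
  of a free action of \<open>Q\<^sub>8\<close>. Hence the map is a covering with deck group \<open>Q\<^sub>8\<close>, and since
  \<open>S\<^sup>3\<close> is simply connected, \<open>g \<mapsto>\<close> (the image of any path from \<open>x\<^sub>0\<close> to \<open>g x\<^sub>0\<close>) is an isomorphism of \<open>Q\<^sub>8\<close>
  onto the fundamental group. The rotation is by \<open>q\<^sup>-\<^sup>1\<close> rather than \<open>q\<close> so that the deck group acts
  from the left; a right action would give an anti-homomorphism.
\<close>

section \<open>Deck group actions\<close>

text \<open>As a set map, \<open>p\<close> is the quotient of \<open>C\<close> by a free action.
  Topological assumptions on \<open>p\<close> are left to the theorems, one of which establishes the
  covering property and the other uses it.\<close>

locale deck_action = group G for G (structure) +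
  fixes C :: "'b::real_normed_vector set"
    and p :: "'b \<Rightarrow> 'c::real_normed_vector"
    and act :: "'a \<Rightarrow> 'b \<Rightarrow> 'b"
  assumes act_closed: "\<lbrakk>g \<in> carrier G; x \<in> C\<rbrakk> \<Longrightarrow> act g x \<in> C"
    and act_one: "x \<in> C \<Longrightarrow> act \<one> x = x"
    and act_mult: "\<lbrakk>g \<in> carrier G; h \<in> carrier G; x \<in> C\<rbrakk> \<Longrightarrow> act (g \<otimes> h) x = act g (act h x)"
    and act_continuous: "g \<in> carrier G \<Longrightarrow> continuous_on C (act g)"
    and act_free: "\<lbrakk>g \<in> carrier G; x \<in> C; act g x = x\<rbrakk> \<Longrightarrow> g = \<one>"
    and fibre_iff: "\<lbrakk>x \<in> C; y \<in> C\<rbrakk> \<Longrightarrow> p x = p y \<longleftrightarrow> (\<exists>g\<in>carrier G. y = act g x)"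
begin

section \<open>Orbits and translates of open sets\<close>

lemma p_act: "\<lbrakk>g \<in> carrier G; x \<in> C\<rbrakk> \<Longrightarrow> p (act g x) = p x"
  using fibre_iff act_closed by metis

lemma act_eq_iff:
  assumes "g \<in> carrier G" "h \<in> carrier G" "x \<in> C" "y \<in> C"
  shows "act g x = act h y \<longleftrightarrow> y = act (inv h \<otimes> g) x"
  using assms by (metis act_closed act_mult act_one inv_closed r_inv l_inv)

lemma act_cancel:
  assumes "g \<in> carrier G" "h \<in> carrier G" "x \<in> C" "act g x = act h x"
  shows "g = h"
  using assms act_eq_iff act_free by (metis inv_closed inv_equality inv_inv m_closed)

text \<open>The image under \<open>g\<close> is the preimage under \<open>inv g\<close>, which acts
  continuously.\<close>

lemma openin_act_image:
  assumes g: "g \<in> carrier G" and U: "openin (top_of_set C) U"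
  shows "openin (top_of_set C) (act g ` U)"
proof -
  have UC: "U \<subseteq> C"
    using U by (rule openin_imp_subset)
  have "act g ` U = C \<inter> act (inv g) -` U"
  proof (intro equalityI subsetI)
    fix y assume "y \<in> act g ` U"
    then show "y \<in> C \<inter> act (inv g) -` U"
      using g UC by (auto simp: act_closed act_one simp flip: act_mult)
  next
    fix y assume y: "y \<in> C \<inter> act (inv g) -` U"
    then have "y = act g (act (inv g) y)"
      using g by (auto simp: act_one simp flip: act_mult)
    with y show "y \<in> act g ` U"
      by blast
  qed
  then show ?thesis
    using continuous_openin_preimage[OF act_continuous _ U, of "inv g"] g act_closed by auto
qed

lemma openin_p_image:
  assumes "compact C" "continuous_on C p" and U: "openin (top_of_set C) U"
  shows "openin (top_of_set (p ` C)) (p ` U)"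
proof -
  have UC: "U \<subseteq> C"
    using U by (rule openin_imp_subset)
  have "C \<inter> p -` p ` U = (\<Union>g\<in>carrier G. act g ` U)"
  proof (intro equalityI subsetI)
    fix y assume "y \<in> C \<inter> p -` p ` U"
    then obtain x where "x \<in> U" "y \<in> C" "p x = p y"
      by auto
    then obtain g where "g \<in> carrier G" "y = act g x"
      using UC fibre_iff by blast
    then show "y \<in> (\<Union>g\<in>carrier G. act g ` U)"
      using \<open>x \<in> U\<close> by blast
  qed (use UC in \<open>auto simp: act_closed p_act subset_iff\<close>)
  then have "openin (top_of_set C) (C \<inter> p -` p ` U)"
    using openin_act_image[OF _ U] by auto
  then show ?thesis
    using Abstract_Topology_2.continuous_imp_quotient_map[OF assms(2) refl assms(1), of "p ` U"] UC by blast
qed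

text \<open>A uniform gap between the points of an orbit lets a small ball meet each orbit at most
  once; the translates of its trace on \<open>C\<close> are the sheets.\<close>

theorem covering_space_separated_orbits:
  assumes comp: "compact C" and cont: "continuous_on C p"
    and "d > 0"
    and sep: "\<And>g x. \<lbrakk>g \<in> carrier G; x \<in> C; g \<noteq> \<one>\<rbrakk> \<Longrightarrow> d \<le> dist x (act g x)"
  shows "covering_space C p (p ` C)"
proof (rule covering_spaceI[OF cont refl])
  fix b assume "b \<in> p ` C"
  then obtain a where a: "a \<in> C" "b = p a"
    by blast
  \<comment> \<open>Points of \<open>U\<close> are less than \<open>d\<close> apart, so no
    nontrivial element carries a point of \<open>U\<close> into \<open>U\<close>.\<close>
  define U where "U = C \<inter> ball a (d/2)"
  have UC: "U \<subseteq> C" and aU: "a \<in> U" and opU: "openin (top_of_set C) U"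
    using a \<open>d > 0\<close> by (auto simp: U_def openin_open_Int)
  have small: "g = \<one>" if "g \<in> carrier G" "y \<in> U" "act g y \<in> U" for g y
  proof (rule ccontr)
    assume "g \<noteq> \<one>"
    then have "d \<le> dist y (act g y)"
      using sep that UC by blast
    moreover have "dist y (act g y) < d"
      using that dist_triangle_half_r[of a y d "act g y"] by (auto simp: U_def)
    ultimately show False
      by simp
  qed
  define v where "v = (\<lambda>g. act g ` U) ` carrier G"
  show "\<exists>T. b \<in> T \<and> openin (top_of_set (p ` C)) T \<and>
          (\<exists>v. \<Union>v = C \<inter> p -` T \<and> (\<forall>u \<in> v. openin (top_of_set C) u) \<and>
            pairwise disjnt v \<and> (\<forall>u \<in> v. \<exists>q. homeomorphism u T p q))"
  proof (rule exI[of _ "p ` U"], intro conjI exI[of _ v] ballI)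
    show "b \<in> p ` U"
      using a aU by blast
    show "openin (top_of_set (p ` C)) (p ` U)"
      by (rule openin_p_image[OF comp cont opU])
    show "\<Union>v = C \<inter> p -` p ` U"
    proof (intro equalityI subsetI)
      fix y assume "y \<in> C \<inter> p -` p ` U"
      then obtain x where "x \<in> U" "y \<in> C" "p x = p y"
        by auto
      then obtain g where "g \<in> carrier G" "y = act g x"
        using UC fibre_iff by blast
      then show "y \<in> \<Union>v"
        using \<open>x \<in> U\<close> by (auto simp: v_def)
    qed (use UC in \<open>auto simp: v_def act_closed p_act subset_iff\<close>)
    show "openin (top_of_set C) u" if "u \<in> v" for u
      using that openin_act_image[OF _ opU] by (auto simp: v_def)
    show "pairwise disjnt v"
    proof (rule pairwiseI)
      fix V W assume VW: "V \<in> v" "W \<in> v" "V \<noteq> W"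
      then obtain g h where gh: "g \<in> carrier G" "h \<in> carrier G" "V = act g ` U" "W = act h ` U"
        by (auto simp: v_def)
      have False if "y \<in> U" "z \<in> U" "act g y = act h z" for y z
      proof -
        have "z = act (inv h \<otimes> g) y"
          using act_eq_iff that gh UC by blast
        then have "inv h \<otimes> g = \<one>"
          using small that gh by auto
        then have "g = h"
          using gh by (metis inv_closed inv_equality inv_inv)
        then show False
          using VW gh by blast
      qed
      then show "disjnt V W"
        unfolding disjnt_def gh by blast
    qed
    fix u assume "u \<in> v"
    then obtain g where g: "g \<in> carrier G" "u = act g ` U"
      by (auto simp: v_def)
    have opu: "openin (top_of_set C) u"
      using openin_act_image[OF g(1) opU] g by simp
    have uC: "u \<subseteq> C"
      using opu by (rule openin_imp_subset)
    have pu: "p ` u = p ` U"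
      using g UC p_act by (force simp: image_image subset_iff intro!: image_cong)
    have "inj_on p u"
    proof (rule inj_onI)
      fix y z assume "y \<in> u" "z \<in> u" and eq: "p y = p z"
      then obtain y' z' where yz: "y' \<in> U" "z' \<in> U" "y = act g y'" "z = act g z'"
        using g by blast
      then have "p y' = p z'"
        using eq g UC p_act by (metis subsetD)
      then obtain h where "h \<in> carrier G" "z' = act h y'"
        using fibre_iff yz UC by blast
      then have "y' = z'"
        using small yz act_one UC by (metis subsetD)
      then show "y = z"
        using yz by simp
    qed
    moreover have "openin (top_of_set (p ` U)) (p ` W)" if "openin (top_of_set u) W" for W
    proof -
      have "openin (top_of_set C) W"
        using that opu by (rule openin_trans)
      then have "openin (top_of_set (p ` C)) (p ` W)"
        by (rule openin_p_image[OF comp cont])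
      moreover have "p ` W \<subseteq> p ` U"
        using that pu openin_imp_subset by blast
      ultimately show ?thesis
        using UC openin_subset_trans by (metis image_mono)
    qed
    ultimately show "\<exists>q. homeomorphism u (p ` U) p q"
      using homeomorphism_injective_open_map[of u p "p ` U"] continuous_on_subset[OF cont uC] pu
      by metis
  qed
qed

text \<open>Simple connectivity makes the class of a projected path depend only on its endpoints,
  which yields multiplicativity. Injectivity comes from monodromy, surjectivity from path
  lifting.\<close>

theorem fundamental_group_covering:
  assumes cov: "covering_space C p S" and sc: "simply_connected C" and x0: "x0 \<in> C"
  shows "fundamental_group S (p x0) \<cong> G"
proof -
  have cont: "continuous_on C p" and im: "p ` C = S"
    using cov covering_space_imp_continuous covering_space_imp_surjective by blast+
  have "\<exists>\<gamma>. path \<gamma> \<and> path_image \<gamma> \<subseteq> C \<and> pathstart \<gamma> = x0 \<and> pathfinish \<gamma> = act g x0"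
    if "g \<in> carrier G" for g
    using simply_connected_imp_path_connected[OF sc] x0 act_closed[OF that x0]
    unfolding path_connected_def by blast
  then obtain \<gamma> where \<gamma>: "\<And>g. g \<in> carrier G \<Longrightarrow> path (\<gamma> g)"
      "\<And>g. g \<in> carrier G \<Longrightarrow> path_image (\<gamma> g) \<subseteq> C"
      "\<And>g. g \<in> carrier G \<Longrightarrow> pathstart (\<gamma> g) = x0"
      "\<And>g. g \<in> carrier G \<Longrightarrow> pathfinish (\<gamma> g) = act g x0"
    by metis
  have proj_path: "path (p \<circ> \<alpha>) \<and> path_image (p \<circ> \<alpha>) \<subseteq> S"
    if "path \<alpha>" "path_image \<alpha> \<subseteq> C" for \<alpha>
    using that cont im
    by (auto simp: path_image_compose intro!: path_continuous_image intro: continuous_on_subset)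
  have proj_homotopic: "homotopic_paths S (p \<circ> \<alpha>) (p \<circ> \<beta>)"
    if "path \<alpha>" "path_image \<alpha> \<subseteq> C" "path \<beta>" "path_image \<beta> \<subseteq> C"
      "pathstart \<alpha> = pathstart \<beta>" "pathfinish \<alpha> = pathfinish \<beta>" for \<alpha> \<beta>
  proof (rule homotopic_paths_continuous_image)
    show "homotopic_paths C \<alpha> \<beta>"
      using sc that unfolding simply_connected_eq_homotopic_paths by simp
  qed (use cont im in auto)
  have loop: "p \<circ> \<gamma> g \<in> loops_at S (p x0)" if "g \<in> carrier G" for g
    using that \<gamma> proj_path x0 p_act
    by (auto simp: loops_at_def pathstart_compose pathfinish_compose)
  define \<phi> where "\<phi> g = path_class S (p \<circ> \<gamma> g)" for g
  have "\<phi> \<in> hom G (fundamental_group S (p x0))"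
  proof (rule homI)
    show "\<phi> g \<in> carrier (fundamental_group S (p x0))" if "g \<in> carrier G" for g
      using loop[OF that] by (simp add: fundamental_group_def \<phi>_def)
    fix g h assume gh: "g \<in> carrier G" "h \<in> carrier G"
    \<comment> \<open>Translation by \<open>g\<close> makes the path for \<open>h\<close> start
      where \<open>\<gamma> g\<close> ends, without changing its projection.\<close>
    define \<delta> where "\<delta> = act g \<circ> \<gamma> h"
    have "continuous_on (path_image (\<gamma> h)) (act g)"
      by (rule continuous_on_subset[OF act_continuous[OF gh(1)] \<gamma>(2)[OF gh(2)]])
    moreover have "\<And>x. x \<in> path_image (\<gamma> h) \<Longrightarrow> x \<in> C"
      using \<gamma>(2) gh by blast
    ultimately have "path \<delta>" "path_image \<delta> \<subseteq> C"
      using gh \<gamma>(1) act_closed by (auto simp: \<delta>_def path_image_compose path_continuous_image)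
    moreover have "pathstart \<delta> = act g x0" "pathfinish \<delta> = act (g \<otimes> h) x0"
      using gh \<gamma>(3,4) act_mult x0 by (simp_all add: \<delta>_def pathstart_compose pathfinish_compose)
    ultimately have \<delta>: "path \<delta>" "path_image \<delta> \<subseteq> C" "pathstart \<delta> = act g x0"
        "pathfinish \<delta> = act (g \<otimes> h) x0"
      by blast+
    have "homotopic_paths S (p \<circ> \<gamma> (g \<otimes> h)) (p \<circ> (\<gamma> g +++ \<delta>))"
      using gh \<gamma> \<delta> by (intro proj_homotopic) (auto simp: path_image_join)
    also have "p \<circ> (\<gamma> g +++ \<delta>) = (p \<circ> \<gamma> g) +++ (p \<circ> \<delta>)"
      by (rule path_compose_join)
    also have "homotopic_paths S \<dots> ((p \<circ> \<gamma> g) +++ (p \<circ> \<gamma> h))"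
    proof (rule homotopic_paths_join)
      show "homotopic_paths S (p \<circ> \<gamma> g) (p \<circ> \<gamma> g)"
        using proj_path \<gamma> gh by simp
      show "homotopic_paths S (p \<circ> \<delta>) (p \<circ> \<gamma> h)"
      \<comment> \<open>Invariance of \<open>p\<close> holds only on \<open>C\<close>, so the two
        projections are compared on the unit interval alone.\<close>
      proof (rule homotopic_paths_eq)
        show "(p \<circ> \<delta>) t = (p \<circ> \<gamma> h) t" if "t \<in> {0..1}" for t
        proof -
          have "\<gamma> h t \<in> C"
            using that \<gamma>(2)[OF gh(2)] by (auto simp: path_image_def)
          then show ?thesis
            using gh by (simp add: \<delta>_def p_act)
        qed
      qed (use proj_path \<delta> in auto)
    qed (use \<gamma> \<delta> gh in \<open>auto simp: pathstart_compose pathfinish_compose\<close>)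
    finally have "\<phi> (g \<otimes> h) = path_class S ((p \<circ> \<gamma> g) +++ (p \<circ> \<gamma> h))"
      unfolding \<phi>_def by (rule path_class_eqI)
    then show "\<phi> (g \<otimes> h) = \<phi> g \<otimes>\<^bsub>fundamental_group S (p x0)\<^esub> \<phi> h"
      using loop gh by (simp add: \<phi>_def fundamental_group_mult)
  qed
  moreover have "inj_on \<phi> (carrier G)"
  proof (rule inj_onI)
    fix g h assume gh: "g \<in> carrier G" "h \<in> carrier G" and "\<phi> g = \<phi> h"
    have "p \<circ> \<gamma> h \<in> path_class S (p \<circ> \<gamma> h)"
      using proj_path \<gamma> gh by (simp add: path_class_def)
    with \<open>\<phi> g = \<phi> h\<close> have "homotopic_paths S (p \<circ> \<gamma> g) (p \<circ> \<gamma> h)"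
      by (auto simp: \<phi>_def path_class_def)
    \<comment> \<open>Lifts of homotopic paths from the common start \<open>x0\<close> end at the
      same point; freeness then identifies \<open>g\<close> and \<open>h\<close>.\<close>
    then have "pathfinish (\<gamma> g) = pathfinish (\<gamma> h)"
      using \<gamma> gh proj_path
      by (intro covering_space_monodromy[OF cov, of "p \<circ> \<gamma> g" "p \<circ> \<gamma> h"]) auto
    then show "g = h"
      using \<gamma> gh act_cancel x0 by auto
  qed
  moreover have "carrier (fundamental_group S (p x0)) \<subseteq> \<phi> ` carrier G"
  proof
    fix P assume "P \<in> carrier (fundamental_group S (p x0))"
    then obtain q where q: "path q" "path_image q \<subseteq> S" "pathstart q = p x0" "pathfinish q = p x0"
      and P: "P = path_class S q"
      by (auto simp: fundamental_group_def loops_at_def)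
    \<comment> \<open>The lift of a loop ends in the fibre of \<open>x0\<close>, hence at some
      \<open>act g x0\<close>, and is therefore homotopic to \<open>\<gamma> g\<close> in
      \<open>C\<close>.\<close>
    obtain h where h: "path h" "path_image h \<subseteq> C" "pathstart h = x0"
      and ph: "\<And>t. t \<in> {0..1} \<Longrightarrow> p (h t) = q t"
      using covering_space_lift_path_strong[OF cov x0 q(1,2,3)] by metis
    have "p x0 = p (pathfinish h)"
      using ph[of 1] q(4) by (simp add: pathfinish_def)
    moreover have "pathfinish h \<in> C"
      using h(2) pathfinish_in_path_image by blast
    ultimately obtain g where g: "g \<in> carrier G" "pathfinish h = act g x0"
      using fibre_iff x0 by blast
    have "homotopic_paths S q (p \<circ> h)"
      by (rule homotopic_paths_eq) (use q ph in auto)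
    also have "homotopic_paths S (p \<circ> h) (p \<circ> \<gamma> g)"
      using h g \<gamma> by (intro proj_homotopic) auto
    finally have "P = \<phi> g"
      unfolding P \<phi>_def by (rule path_class_eqI)
    with g show "P \<in> \<phi> ` carrier G"
      by blast
  qed
  ultimately have "\<phi> \<in> iso G (fundamental_group S (p x0))"
    by (auto simp: iso_iff hom_def)
  then show ?thesis
    using iso_sym is_isoI by blast
qed

end

section \<open>Frames of unit quaternions\<close>

lemma vector_4 [simp]:
  "(vector [a, b, c, d] :: ('a::zero)^4) $ 1 = a"
  "(vector [a, b, c, d] :: ('a::zero)^4) $ 2 = b"
  "(vector [a, b, c, d] :: ('a::zero)^4) $ 3 = c"
  "(vector [a, b, c, d] :: ('a::zero)^4) $ 4 = d"
  unfolding vector_def by simp_all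

text \<open>Left multiplication by 1, i, j, k; coordinate 1 is the real part, coordinates 2 to 4 are
  the coefficients of i, j, k.\<close>

fun quat_unit_act :: "quat_unit \<Rightarrow> real^4 \<Rightarrow> real^4" where
  "quat_unit_act QE q = q"
| "quat_unit_act QI q = vector [- (q$2), q$1, - (q$4), q$3]"
| "quat_unit_act QJ q = vector [- (q$3), q$4, q$1, - (q$2)]"
| "quat_unit_act QK q = vector [- (q$4), - (q$3), q$2, q$1]"

definition Q8_act :: "int \<times> quat_unit \<Rightarrow> real^4 \<Rightarrow> real^4" where
  "Q8_act g q = of_int (fst g) *\<^sub>R quat_unit_act (snd g) q"

text \<open>The vectors \<open>frame1 q\<close>, \<open>frame2 q\<close>, \<open>frame3 q\<close> are the imaginary quaternions
  \<open>q\<^sup>* \<i> q\<close>, \<open>q\<^sup>* \<j> q\<close>, \<open>q\<^sup>* \<k> q\<close>, with \<open>q\<^sup>*\<close> the conjugate of \<open>q\<close>.\<close>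

definition frame1 :: "real^4 \<Rightarrow> real^3" where
  "frame1 q = vector [(q$1)\<^sup>2 + (q$2)\<^sup>2 - (q$3)\<^sup>2 - (q$4)\<^sup>2,
     2 * (q$2 * q$3 - q$1 * q$4), 2 * (q$2 * q$4 + q$1 * q$3)]"

definition frame2 :: "real^4 \<Rightarrow> real^3" where
  "frame2 q = vector [2 * (q$2 * q$3 + q$1 * q$4),
     (q$1)\<^sup>2 - (q$2)\<^sup>2 + (q$3)\<^sup>2 - (q$4)\<^sup>2, 2 * (q$3 * q$4 - q$1 * q$2)]"

definition frame3 :: "real^4 \<Rightarrow> real^3" where
  "frame3 q = vector [2 * (q$2 * q$4 - q$1 * q$3), 2 * (q$3 * q$4 + q$1 * q$2),
     (q$1)\<^sup>2 - (q$2)\<^sup>2 - (q$3)\<^sup>2 + (q$4)\<^sup>2]"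

definition biaxial_map :: "real \<Rightarrow> real^4 \<Rightarrow> real^3^3" where
  "biaxial_map r q = r *\<^sub>R (frame1 q \<otimes>\<^sub>v frame1 q - frame2 q \<otimes>\<^sub>v frame2 q)"

section \<open>Unit vectors and tensors up to sign\<close>

lemma inner_4: "(x::real^4) \<bullet> y = x$1 * y$1 + x$2 * y$2 + x$3 * y$3 + x$4 * y$4"
  by (simp add: inner_vec_def sum_4)

lemma inner_3: "(x::real^3) \<bullet> y = x$1 * y$1 + x$2 * y$2 + x$3 * y$3"
  by (simp add: inner_vec_def sum_3)

text \<open>Equality case of Cauchy-Schwarz: the squared norms of \<open>v - u\<close> and
  \<open>v + u\<close> are 2 - 2 (\<open>u \<bullet> v\<close>) and 2 + 2
  (\<open>u \<bullet> v\<close>), and one of them vanishes.\<close>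

lemma unit_vectors_parallel:
  assumes "norm u = 1" "norm v = 1" "(u \<bullet> v)\<^sup>2 = 1"
  shows "v = u \<or> v = - u"
proof -
  have "u \<bullet> u = 1" "v \<bullet> v = 1"
    using assms by (simp_all add: norm_eq_1)
  moreover have "u \<bullet> v = 1 \<or> u \<bullet> v = -1"
    using assms(3) by (simp add: power2_eq_1_iff)
  ultimately have "(v - u) \<bullet> (v - u) = 0 \<or> (v + u) \<bullet> (v + u) = 0"
    by (auto simp: inner_diff inner_add inner_commute algebra_simps)
  then show ?thesis
    by (simp add: eq_neg_iff_add_eq_0)
qed

lemma tensor_vec_mult: "(u \<otimes>\<^sub>v v) *v x = (v \<bullet> x) *\<^sub>R u"
  by (simp add: tensor_vec_def matrix_vector_mult_def vec_eq_iff inner_vec_def sum_distrib_right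
      sum_distrib_left mult_ac)

text \<open>Both sides define the same quadratic form. The right side takes the values 1 at
  \<open>n'\<close> and -1 at \<open>m'\<close>; the left side is a difference of squares bounded by
  1, so these extreme values force \<open>n'\<close> parallel to \<open>n\<close> and
  \<open>m'\<close> to \<open>m\<close>.\<close>

lemma tensor_difference_eq:
  assumes "norm n = 1" "norm m = 1" "norm n' = 1" "norm m' = 1" "n' \<bullet> m' = 0"
    and eq: "n \<otimes>\<^sub>v n - m \<otimes>\<^sub>v m = n' \<otimes>\<^sub>v n' - m' \<otimes>\<^sub>v m'"
  shows "(n' = n \<or> n' = - n) \<and> (m' = m \<or> m' = - m)"
proof -
  have form: "x \<bullet> ((u \<otimes>\<^sub>v u - v \<otimes>\<^sub>v v) *v x) = (u \<bullet> x)\<^sup>2 - (v \<bullet> x)\<^sup>2" for u v x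
    by (simp add: matrix_vector_mult_diff_rdistrib tensor_vec_mult inner_diff_right inner_commute
        power2_eq_square)
  have form_eq: "(n \<bullet> x)\<^sup>2 - (m \<bullet> x)\<^sup>2 = (n' \<bullet> x)\<^sup>2 - (m' \<bullet> x)\<^sup>2" for x
    using eq form by metis
  have le_1: "(u \<bullet> v)\<^sup>2 \<le> 1" if "norm u = 1" "norm v = 1" for u v :: "real^3"
    using Cauchy_Schwarz_ineq[of u v] that by (simp add: norm_eq_1)
  have "n' \<bullet> n' = 1" "m' \<bullet> m' = 1"
    using assms by (simp_all add: norm_eq_1)
  then have "(n \<bullet> n')\<^sup>2 - (m \<bullet> n')\<^sup>2 = 1" "(n \<bullet> m')\<^sup>2 - (m \<bullet> m')\<^sup>2 = - 1"
    using form_eq[of n'] form_eq[of m'] assms(5) by (simp_all add: inner_commute)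
  moreover have "(n \<bullet> n')\<^sup>2 \<le> 1" "(m \<bullet> m')\<^sup>2 \<le> 1"
    using le_1 assms by blast+
  ultimately have "(n \<bullet> n')\<^sup>2 = 1" "(m \<bullet> m')\<^sup>2 = 1"
    by (smt (verit) zero_le_power2)+
  then show ?thesis
    using unit_vectors_parallel assms by blast
qed

text \<open>As polynomial identities these hold for every \<open>q\<close>; for unit
  \<open>q\<close> they say that the frame is orthonormal.\<close>

lemma inner_frame:
  "frame1 q \<bullet> frame1 q = (q \<bullet> q)\<^sup>2" "frame2 q \<bullet> frame2 q = (q \<bullet> q)\<^sup>2" "frame3 q \<bullet> frame3 q = (q \<bullet> q)\<^sup>2"
  "frame1 q \<bullet> frame2 q = 0" "frame1 q \<bullet> frame3 q = 0" "frame2 q \<bullet> frame3 q = 0"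
  by (simp_all add: frame1_def frame2_def frame3_def inner_3 inner_4 power2_eq_square algebra_simps)

text \<open>For unit \<open>q\<close> the third frame vector is thus determined by the first
  two.\<close>

lemma cross_frame: "cross3 (frame1 q) (frame2 q) = (q \<bullet> q) *\<^sub>R frame3 q"
  by (simp add: frame1_def frame2_def frame3_def inner_4 cross3_def vec_eq_iff forall_3
      power2_eq_square algebra_simps)

lemma frame_expansion:
  "(x \<bullet> frame1 q) *\<^sub>R frame1 q + (x \<bullet> frame2 q) *\<^sub>R frame2 q + (x \<bullet> frame3 q) *\<^sub>R frame3 q
     = (q \<bullet> q)\<^sup>2 *\<^sub>R x"
  by (simp add: frame1_def frame2_def frame3_def inner_3 inner_4 vec_eq_iff forall_3
      power2_eq_square algebra_simps)

section \<open>Every orthonormal pair comes from a unit quaternion\<close>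

lemma norm_frame:
  assumes "norm q = 1"
  shows "norm (frame1 q) = 1" "norm (frame2 q) = 1"
  using assms by (simp_all add: norm_eq_1 inner_frame)

text \<open>The argument is (x + y i) q. The factor x + y i commutes with i, while (x - y i) j (x +
  y i) = j (x + y i)^2, so the other two vectors turn by the doubled angle.\<close>

lemma frame_rotate:
  "frame1 (x *\<^sub>R q + y *\<^sub>R quat_unit_act QI q) = (x\<^sup>2 + y\<^sup>2) *\<^sub>R frame1 q"
  "frame2 (x *\<^sub>R q + y *\<^sub>R quat_unit_act QI q) =
     (x\<^sup>2 - y\<^sup>2) *\<^sub>R frame2 q - (2 * x * y) *\<^sub>R frame3 q"
  by (simp_all add: frame1_def frame2_def frame3_def vec_eq_iff forall_3 power2_eq_square
      algebra_simps)

text \<open>Reading \<open>n\<close> as an imaginary quaternion, i (1 - i n) = n + i = (1 - i n) n,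
  so 1 - i n conjugates i to n. It vanishes only at n = -i, where j serves instead.\<close>

lemma frame1_surj:
  assumes "norm n = 1"
  obtains q where "norm q = 1" "frame1 q = n"
proof (cases "n$1 = -1")
  case True
  have nn: "(n$1)\<^sup>2 + (n$2)\<^sup>2 + (n$3)\<^sup>2 = 1"
    using assms by (simp add: norm_eq_1 inner_3 power2_eq_square)
  then have "n$2 = 0" "n$3 = 0"
    using True by (simp_all add: sum_power2_eq_zero_iff)
  then have "norm (vector [0, 0, 1, 0] :: real^4) = 1" "frame1 (vector [0, 0, 1, 0]) = n"
    using True by (simp_all add: norm_eq_1 inner_4 frame1_def vec_eq_iff forall_3)
  then show thesis
    by (rule that)
next
  case False
  have nn: "(n$1)\<^sup>2 + (n$2)\<^sup>2 + (n$3)\<^sup>2 = 1"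
    using assms by (simp add: norm_eq_1 inner_3 power2_eq_square)
  have "\<bar>n$1\<bar> \<le> 1"
    using component_le_norm_cart[of n 1] assms by simp
  then have pos: "1 + n$1 > 0"
    using False by simp
  \<comment> \<open>The squared norm of 1 - i n is 2 (1 + \<open>n$1\<close>), so \<open>c\<close>
    normalises it; \<open>q\<close> below is c (1 - i n) in coordinates.\<close>
  define c where "c = 1 / sqrt (2 * (1 + n$1))"
  have c: "c * c * (2 * (1 + n$1)) = 1"
    using pos by (simp add: c_def)
  define q :: "real^4" where "q = vector [c * (1 + n$1), 0, c * n$3, - c * n$2]"
  have "q \<bullet> q = c * c * ((1 + n$1)\<^sup>2 + (n$2)\<^sup>2 + (n$3)\<^sup>2)"
    by (simp add: q_def inner_4 power2_eq_square algebra_simps)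
  also have "(1 + n$1)\<^sup>2 + (n$2)\<^sup>2 + (n$3)\<^sup>2 = 2 * (1 + n$1)"
    using nn by (simp add: power2_eq_square algebra_simps)
  finally have "norm q = 1"
    using c by (simp add: norm_eq_1)
  moreover have "frame1 q = n"
  proof -
    have "frame1 q $ 1 = c * c * ((1 + n$1)\<^sup>2 - ((n$2)\<^sup>2 + (n$3)\<^sup>2))"
      by (simp add: q_def frame1_def power2_eq_square algebra_simps)
    also have "(1 + n$1)\<^sup>2 - ((n$2)\<^sup>2 + (n$3)\<^sup>2) = 2 * (1 + n$1) * n$1"
      using nn by (simp add: power2_eq_square algebra_simps)
    finally have "frame1 q $ 1 = (c * c * (2 * (1 + n$1))) * n$1"
      by (simp add: mult.assoc)
    moreover have "frame1 q $ 2 = (c * c * (2 * (1 + n$1))) * n$2"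
      "frame1 q $ 3 = (c * c * (2 * (1 + n$1))) * n$3"
      by (simp_all add: q_def frame1_def)
    ultimately show ?thesis
      using c by (simp add: vec_eq_iff forall_3)
  qed
  ultimately show thesis
    by (rule that)
qed

text \<open>After \<open>n\<close> is matched, left multiplication by a unit x + y i fixes it and
  rotates the second frame vector within the plane orthogonal to \<open>n\<close> until it meets
  \<open>m\<close>.\<close>

lemma frame_surj:
  assumes "norm n = 1" "norm m = 1" "n \<bullet> m = 0"
  obtains q where "norm q = 1" "frame1 q = n" "frame2 q = m"
proof -
  obtain q where q: "norm q = 1" "frame1 q = n"
    using frame1_surj[OF assms(1)] .
  have qq: "q \<bullet> q = 1"
    using q by (simp add: norm_eq_1)
  define \<alpha> \<beta> where "\<alpha> = m \<bullet> frame2 q" and "\<beta> = m \<bullet> frame3 q"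
  have m: "m = \<alpha> *\<^sub>R frame2 q + \<beta> *\<^sub>R frame3 q"
    using frame_expansion[of m q] assms(3) by (simp add: qq q inner_commute \<alpha>_def \<beta>_def)
  have "1 = m \<bullet> m"
    using assms by (simp add: norm_eq_1)
  also have "\<dots> = m \<bullet> (\<alpha> *\<^sub>R frame2 q + \<beta> *\<^sub>R frame3 q)"
    using m by simp
  also have "\<dots> = \<alpha>\<^sup>2 + \<beta>\<^sup>2"
    by (simp add: inner_add_right power2_eq_square \<alpha>_def \<beta>_def)
  finally obtain t where t: "\<alpha> = cos t" "\<beta> = sin t"
    using sincos_total_2pi by metis
  \<comment> \<open>Half the angle, since \<open>frame_rotate\<close> doubles it; the sign of
    \<open>y\<close> cancels the minus before \<open>frame3\<close>.\<close>
  define x y where "x = cos (t/2)" and "y = - sin (t/2)"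
  have xy: "x\<^sup>2 + y\<^sup>2 = 1" "x\<^sup>2 - y\<^sup>2 = \<alpha>" "- (2 * x * y) = \<beta>"
    using cos_double[of "t/2"] sin_double[of "t/2"] by (simp_all add: x_def y_def t)
  define q' where "q' = x *\<^sub>R q + y *\<^sub>R quat_unit_act QI q"
  have "frame1 q' = n"
    by (simp only: q'_def frame_rotate xy q scaleR_one)
  moreover have "frame2 q' = m"
    unfolding q'_def frame_rotate m by (simp add: xy(2) flip: xy(3))
  moreover have "norm q' = 1"
  proof -
    have "q' \<bullet> q' = (x\<^sup>2 + y\<^sup>2) * (q \<bullet> q)"
      by (simp add: q'_def inner_4 power2_eq_square algebra_simps)
    then show ?thesis
      by (simp add: norm_eq_1 xy qq)
  qed
  ultimately show thesis
    using that by blast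
qed

text \<open>The frame of a unit quaternion determines all products \<open>q$i * q$j\<close>, hence
  \<open>(q \<bullet> q')\<^sup>2 = (q \<bullet> q)\<^sup>2 = 1\<close>.\<close>

lemma frame_eq_imp:
  assumes "norm q = 1" "norm q' = 1" "frame1 q = frame1 q'" "frame2 q = frame2 q'"
  shows "q' = q \<or> q' = - q"
proof -
  have qq: "q \<bullet> q = 1" "q' \<bullet> q' = 1"
    using assms by (simp_all add: norm_eq_1)
  then have "frame3 q = frame3 q'"
    using cross_frame[of q] cross_frame[of q'] assms by simp
  \<comment> \<open>Diagonal frame entries and \<open>q \<bullet> q = 1\<close> give the squares;
    sums and differences of mirrored off-diagonal entries give the mixed products.\<close>
  then have "q$1 * q$1 = q'$1 * q'$1" "q$2 * q$2 = q'$2 * q'$2" "q$3 * q$3 = q'$3 * q'$3"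
    "q$4 * q$4 = q'$4 * q'$4" "q$1 * q$2 = q'$1 * q'$2" "q$1 * q$3 = q'$1 * q'$3"
    "q$1 * q$4 = q'$1 * q'$4" "q$2 * q$3 = q'$2 * q'$3" "q$2 * q$4 = q'$2 * q'$4"
    "q$3 * q$4 = q'$3 * q'$4"
    using assms(3,4) qq
    by (simp_all add: frame1_def frame2_def frame3_def inner_4 vec_eq_iff forall_3 power2_eq_square)
  then have products: "q$i * q$j = q'$i * q'$j" for i j
    using exhaust_4[of i] exhaust_4[of j] by (auto simp: mult.commute)
  have "(q \<bullet> q')\<^sup>2 = (\<Sum>i\<in>UNIV. \<Sum>j\<in>UNIV. (q$i * q$j) * (q'$i * q'$j))"
    by (simp add: inner_vec_def power2_eq_square sum_product mult_ac)
  also have "\<dots> = (\<Sum>i\<in>UNIV. \<Sum>j\<in>UNIV. (q$i * q$j) * (q$i * q$j))"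
    by (simp add: products)
  also have "\<dots> = (q \<bullet> q)\<^sup>2"
    by (simp add: inner_vec_def power2_eq_square sum_product mult_ac)
  finally show ?thesis
    using unit_vectors_parallel assms qq by simp
qed

section \<open>The quaternion group acting by isometries\<close>

lemma Q8_act_mult:
  "Q8_act (g \<otimes>\<^bsub>Q8\<^esub> h) q = Q8_act g (Q8_act h q)"
  by (cases g; cases h; cases "snd g"; cases "snd h")
     (simp_all add: Q8_def Q8_act_def vec_eq_iff forall_4)

lemma Q8_act_diff: "Q8_act g x - Q8_act g y = Q8_act g (x - y)"
  by (cases "snd g") (simp_all add: Q8_act_def vec_eq_iff forall_4 algebra_simps)

lemma norm_Q8_act:
  assumes "g \<in> carrier Q8"
  shows "norm (Q8_act g q) = norm q"
proof -
  have "quat_unit_act e q \<bullet> quat_unit_act e q = q \<bullet> q" for e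
    by (cases e) (simp_all add: inner_4)
  then show ?thesis
    using assms by (auto simp: Q8_act_def norm_eq_sqrt_inner Q8_def)
qed

text \<open>Multiplication by an imaginary unit turns \<open>q\<close> into an orthogonal vector;
  the remaining nontrivial element sends \<open>q\<close> to \<open>- q\<close>.\<close>

lemma inner_Q8_act_nonpos:
  assumes "g \<in> carrier Q8" "g \<noteq> \<one>\<^bsub>Q8\<^esub>"
  shows "q \<bullet> Q8_act g q \<le> 0"
proof -
  have "g = (-1, QE) \<or> snd g \<noteq> QE"
    using assms by (cases g) (auto simp: Q8_def)
  moreover have "q \<bullet> quat_unit_act e q = 0" if "e \<noteq> QE" for e
    using that by (cases e) (simp_all add: inner_4)
  ultimately show ?thesis
    by (auto simp: Q8_act_def)
qed

text \<open>This is the uniform gap for the covering criterion, and it also yields freeness. The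
  squared distance is in fact at least 2.\<close>

lemma dist_Q8_act_ge_1:
  assumes "g \<in> carrier Q8" "g \<noteq> \<one>\<^bsub>Q8\<^esub>" "norm q = 1"
  shows "1 \<le> dist q (Q8_act g q)"
proof -
  have "norm (Q8_act g q) = 1"
    using norm_Q8_act assms by simp
  then have "(dist q (Q8_act g q))\<^sup>2 = 2 - 2 * (q \<bullet> Q8_act g q)"
    using assms(3)
    by (simp add: dist_norm power2_norm_eq_inner inner_diff inner_commute norm_eq_1)
  then have "1\<^sup>2 \<le> (dist q (Q8_act g q))\<^sup>2"
    using inner_Q8_act_nonpos[OF assms(1,2), of q] by simp
  then show ?thesis
    by (rule power2_le_imp_le) simp
qed

text \<open>The units 1, i, j, k realise the four sign patterns of the first two frame
  vectors.\<close>

lemma frame_quat_unit_act: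
  "frame1 (quat_unit_act QI q) = frame1 q" "frame2 (quat_unit_act QI q) = - frame2 q"
  "frame1 (quat_unit_act QJ q) = - frame1 q" "frame2 (quat_unit_act QJ q) = frame2 q"
  "frame1 (quat_unit_act QK q) = - frame1 q" "frame2 (quat_unit_act QK q) = - frame2 q"
  "frame1 (- q) = frame1 q" "frame2 (- q) = frame2 q"
  by (simp_all add: frame1_def frame2_def vec_eq_iff forall_3)

section \<open>Fibres, image and continuity of the biaxial map\<close>

lemma tensor_vec_minus: "(- u) \<otimes>\<^sub>v (- u) = u \<otimes>\<^sub>v u"
  by (simp add: tensor_vec_def)

lemma biaxial_map_Q8_act:
  assumes "g \<in> carrier Q8"
  shows "biaxial_map r (Q8_act g q) = biaxial_map r q"
  using assms
  by (cases g; cases "snd g")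
     (auto simp: Q8_def Q8_act_def biaxial_map_def frame_quat_unit_act tensor_vec_minus
       simp del: quat_unit_act.simps(2-4))

text \<open>Equal tensors fix the two frame vectors up to signs, which select a unit
  \<open>e\<close>; the frame then fixes the quaternion up to sign, which selects the sign of
  \<open>g\<close>.\<close>

lemma biaxial_map_eq_imp:
  assumes "r > 0" "norm q = 1" "norm q' = 1" "biaxial_map r q = biaxial_map r q'"
  obtains g where "g \<in> carrier Q8" "q' = Q8_act g q"
proof -
  have "frame1 q \<otimes>\<^sub>v frame1 q - frame2 q \<otimes>\<^sub>v frame2 q = frame1 q' \<otimes>\<^sub>v frame1 q' - frame2 q' \<otimes>\<^sub>v frame2 q'"
    using assms by (simp add: biaxial_map_def)
  then have "(frame1 q' = frame1 q \<or> frame1 q' = - frame1 q) \<and>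
      (frame2 q' = frame2 q \<or> frame2 q' = - frame2 q)"
    using tensor_difference_eq norm_frame assms(2,3) inner_frame(4) by blast
  then obtain e where "frame1 q' = frame1 (quat_unit_act e q)" "frame2 q' = frame2 (quat_unit_act e q)"
    using frame_quat_unit_act quat_unit_act.simps(1) by metis
  moreover have "norm (quat_unit_act e q) = 1"
    using norm_Q8_act[of "(1, e)" q] assms(2) by (cases e) (simp_all add: Q8_act_def Q8_def)
  ultimately have "q' = quat_unit_act e q \<or> q' = - quat_unit_act e q"
    using frame_eq_imp assms(3) by metis
  then have "q' = Q8_act (1, e) q \<or> q' = Q8_act (-1, e) q"
    by (simp add: Q8_act_def)
  moreover have "(1, e) \<in> carrier Q8" "(-1, e) \<in> carrier Q8"
    by (cases e; simp add: Q8_def)+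
  ultimately show thesis
    using that by blast
qed

lemma biaxial_map_image: "biaxial_map r ` sphere 0 1 = biaxial_manifold r"
proof (intro equalityI subsetI)
  fix A assume "A \<in> biaxial_map r ` sphere 0 1"
  then show "A \<in> biaxial_manifold r"
    unfolding biaxial_manifold_def biaxial_map_def using norm_frame inner_frame(4) by fastforce
next
  fix A assume "A \<in> biaxial_manifold r"
  then obtain n m where nm: "norm n = 1" "norm m = 1" "n \<bullet> m = 0"
    and A: "A = r *\<^sub>R (n \<otimes>\<^sub>v n - m \<otimes>\<^sub>v m)"
    by (auto simp: biaxial_manifold_def)
  obtain q where "norm q = 1" "frame1 q = n" "frame2 q = m"
    using frame_surj[OF nm] .
  then show "A \<in> biaxial_map r ` sphere 0 1"
    by (auto simp: A biaxial_map_def)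
qed

lemma continuous_on_vector_3:
  fixes f g h :: "'a::topological_space \<Rightarrow> real"
  assumes "continuous_on S f" "continuous_on S g" "continuous_on S h"
  shows "continuous_on S (\<lambda>x. vector [f x, g x, h x] :: real^3)"
proof -
  have "(\<lambda>x. vector [f x, g x, h x] :: real^3) =
      (\<lambda>x. \<chi> i. if i = 1 then f x else if i = 2 then g x else h x)"
    by (auto simp: vec_eq_iff forall_3)
  moreover have "continuous_on S (\<lambda>x. if i = 1 then f x else if i = 2 then g x else h x)" for i :: 3
    using assms by (cases "i = 1"; cases "i = 2") simp_all
  ultimately show ?thesis
    by (simp only:) (rule continuous_on_vec_lambda)
qed

lemma continuous_on_biaxial_map: "continuous_on S (biaxial_map r)"
proof -
  have "continuous_on S frame1" "continuous_on S frame2"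
    unfolding frame1_def[abs_def] frame2_def[abs_def]
    by (intro continuous_on_vector_3 continuous_intros)+
  then show ?thesis
    unfolding biaxial_map_def[abs_def] tensor_vec_def
    by (intro continuous_intros continuous_on_vec_lambda)
qed

section \<open>Quotient by the quaternion group\<close>

lemma deck_action_biaxial_map:
  assumes "r > 0"
  shows "deck_action Q8 (sphere 0 1) (biaxial_map r) Q8_act"
proof -
  interpret group Q8
    by (rule Q8_group)
  show ?thesis
  proof
    show "Q8_act g x \<in> sphere 0 1" if "g \<in> carrier Q8" "x \<in> sphere 0 1" for g x
      using that norm_Q8_act by simp
    show "Q8_act \<one>\<^bsub>Q8\<^esub> x = x" for x
      by (simp add: Q8_def Q8_act_def)
    show "Q8_act (g \<otimes>\<^bsub>Q8\<^esub> h) x = Q8_act g (Q8_act h x)" for g h x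
      by (rule Q8_act_mult)
    \<comment> \<open>Each element acts as an isometry.\<close>
    show "continuous_on (sphere 0 1) (Q8_act g)" if "g \<in> carrier Q8" for g
      unfolding continuous_on_iff dist_norm Q8_act_diff norm_Q8_act[OF that] by blast
    show "g = \<one>\<^bsub>Q8\<^esub>" if "g \<in> carrier Q8" "x \<in> sphere 0 1" "Q8_act g x = x" for g x
      using dist_Q8_act_ge_1[of g x] that by force
    show "biaxial_map r x = biaxial_map r y \<longleftrightarrow> (\<exists>g\<in>carrier Q8. y = Q8_act g x)"
      if "x \<in> sphere 0 1" "y \<in> sphere 0 1" for x y
      using that biaxial_map_eq_imp[OF assms, of x y] biaxial_map_Q8_act by auto
  qed
qed

theorem lemma4p18:
  fixes r :: real
  assumes "r > 0"
  shows "(\<forall>A \<in> biaxial_manifold r. fundamental_group (biaxial_manifold r) A \<cong> Q8) \<and>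
         (\<exists>p. universal_covering_space (sphere 0 1 :: (real^4) set) p (biaxial_manifold r))"
proof -
  interpret deck_action Q8 "sphere 0 1" "biaxial_map r" Q8_act
    by (rule deck_action_biaxial_map[OF assms])
  have "covering_space (sphere 0 1) (biaxial_map r) (biaxial_map r ` sphere 0 1)"
  proof (rule covering_space_separated_orbits)
    show "1 \<le> dist x (Q8_act g x)"
      if "g \<in> carrier Q8" "x \<in> sphere 0 1" "g \<noteq> \<one>\<^bsub>Q8\<^esub>" for g x
      using dist_Q8_act_ge_1 that by simp
  qed (simp_all add: continuous_on_biaxial_map)
  then have cov: "covering_space (sphere 0 1) (biaxial_map r) (biaxial_manifold r)"
    by (simp add: biaxial_map_image)
  have sc: "simply_connected (sphere 0 1 :: (real^4) set)"
    by (rule simply_connected_sphere) simp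
  \<comment> \<open>Any quaternion over \<open>A\<close> can serve as the base point
    upstairs.\<close>
  have "fundamental_group (biaxial_manifold r) A \<cong> Q8" if A: "A \<in> biaxial_manifold r" for A
  proof -
    obtain q where "q \<in> sphere 0 1" "A = biaxial_map r q"
      using A unfolding biaxial_map_image[symmetric] by blast
    then show ?thesis
      using fundamental_group_covering[OF cov sc] by simp
  qed
  then show ?thesis
    using cov sc unfolding universal_covering_space_def by blast
qed

end
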